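(* Let $d\ge 1$, let $\mathcal D$ be a collection of bounded domains in $\mathbb C^d$, and let $D,D'\in\mathcal D$. Let an abstract boundary $\partial_\ast$ suitable for $\mathcal D$ be given. If $D$ is a model domain and $D'$ is a quasi-model domain for this abstract boundary, then every biholomorphism $F:D\to D'$ extends continuously to a map from $\overline{D}$ to $\overline{D'}$ (Euclidean closures). The extension of $F$ is given by $\mathsf{id}_{D'}^\ast\circ F^\ast\circ(\mathsf{id}_{D}^\ast)^{-1}$.
   Context: For a bounded domain (connected open set) $D\subset\mathbb C^d$, $\overline D$ denotes its closure in $\mathbb C^d$ with the Euclidean topology. An abstract boundary $\partial_\ast D$ for $D$ is a topological space such that the disjoint union $\overline{D}^\ast:=D\sqcup\partial_\ast D$ is equipped with a topology whose restriction to $D$ is the Euclidean topology and whose restriction to $\partial_\ast D$ is the topology of $\partial_\ast D$. Let $\mathcal D$ be a collection of bounded domains in $\mathbb C^d$, and let an abstract boundary $\partial_\ast D$ (with the topological space $\overline{D}^\ast$) be assigned to each $D\in\mathcal D$. This abstract boundary is suitable for $\mathcal D$ if for every biholomorphism $F:D\to D'$ with $D,D'\in\mathcal D$ there exists a homeomorphism $F^\ast:\overline{D}^\ast\to\overline{D'}^\ast$ such that $F^\ast|_D=F$. A domain $D\in\mathcal D$ is a model domain for an abstract boundary suitable for $\mathcal D$ if the identity map $\mathsf{id}:D\to D$ extends to a homeomorphism $\mathsf{id}_D^\ast:\overline{D}^\ast\to\overline{D}$. It is a quasi-model domain if the identity map $\mathsf{id}:D\to D$ extends to a sequentially continuous surjective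 map $\mathsf{id}_D^\ast:\overline{D}^\ast\to\overline{D}$. *)

theory Defs
  imports "HOL-Analysis.Analysis"
begin

text \<open>Complex \<open>d\<close>-space is rendered as \<^typ>\<open>complex ^ 'd\<close>, with \<open>d = CARD('d) \<ge> 1\<close>.\<close>

definition bounded_domain :: "(complex ^ 'd) set \<Rightarrow> bool" where
  "bounded_domain D \<longleftrightarrow> open D \<and> connected D \<and> bounded D"

text \<open>Holomorphy in several variables: the real Frechet derivative exists at every point of
  the open set \<open>D\<close> and is complex-linear (additivity is part of \<open>has_derivative\<close>).\<close>

definition holomorphic_map_on ::
    "(complex ^ 'd \<Rightarrow> complex ^ 'e) \<Rightarrow> (complex ^ 'd) set \<Rightarrow> bool" where
  "holomorphic_map_on f D \<longleftrightarrow>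
     (\<forall>z\<in>D. \<exists>L. (f has_derivative L) (at z) \<and> (\<forall>c v. L (c *s v) = c *s L v))"

definition biholomorphism ::
    "(complex ^ 'd) set \<Rightarrow> (complex ^ 'd) set \<Rightarrow> (complex ^ 'd \<Rightarrow> complex ^ 'd) \<Rightarrow> bool" where
  "biholomorphism D D' F \<longleftrightarrow>
     bij_betw F D D' \<and> holomorphic_map_on F D \<and> holomorphic_map_on (inv_into D F) D'"

text \<open>\<open>B\<close> is the boundary space and \<open>X\<close> the topology on the disjoint union of \<open>D\<close> and \<open>B\<close>.
  Neither openness nor density of \<open>D\<close> in \<open>X\<close> is required.\<close>

definition abstract_boundary ::
    "(complex ^ 'd) set \<Rightarrow> 'b topology \<Rightarrow> (complex ^ 'd + 'b) topology \<Rightarrow> bool" where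
  "abstract_boundary D B X \<longleftrightarrow>
     topspace X = D <+> topspace B \<and>
     embedding_map (top_of_set D) X Inl \<and>
     embedding_map B X Inr"

definition star_extension ::
    "(complex ^ 'd) set \<Rightarrow> (complex ^ 'd + 'b) topology \<Rightarrow>
     (complex ^ 'd) set \<Rightarrow> (complex ^ 'd + 'b) topology \<Rightarrow>
     (complex ^ 'd \<Rightarrow> complex ^ 'd) \<Rightarrow> (complex ^ 'd + 'b \<Rightarrow> complex ^ 'd + 'b) \<Rightarrow> bool" where
  "star_extension D X D' X' F Fs \<longleftrightarrow>
     homeomorphic_map X X' Fs \<and> (\<forall>z\<in>D. Fs (Inl z) = Inl (F z))"

text \<open>\<open>T D\<close> is the topological space assigned to \<open>D\<close>, i.e. \<open>D\<close> together with its
  abstract boundary.\<close>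

definition suitable ::
    "(complex ^ 'd) set set \<Rightarrow> ((complex ^ 'd) set \<Rightarrow> (complex ^ 'd + 'b) topology) \<Rightarrow> bool" where
  "suitable \<D> T \<longleftrightarrow>
     (\<forall>D\<in>\<D>. \<forall>D'\<in>\<D>. \<forall>F. biholomorphism D D' F \<longrightarrow>
        (\<exists>Fs. star_extension D (T D) D' (T D') F Fs))"

definition sequentially_continuous_map ::
    "'a topology \<Rightarrow> 'b topology \<Rightarrow> ('a \<Rightarrow> 'b) \<Rightarrow> bool" where
  "sequentially_continuous_map X Y f \<longleftrightarrow>
     f ` topspace X \<subseteq> topspace Y \<and>
     (\<forall>x l. (\<forall>n::nat. x n \<in> topspace X) \<and> limitin X x l sequentially \<longrightarrow>
        limitin Y (\<lambda>n. f (x n)) (f l) sequentially)"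

definition model_map ::
    "(complex ^ 'd) set \<Rightarrow> (complex ^ 'd + 'b) topology \<Rightarrow> (complex ^ 'd + 'b \<Rightarrow> complex ^ 'd) \<Rightarrow> bool"
  where
  "model_map D X i \<longleftrightarrow>
     homeomorphic_map X (top_of_set (closure D)) i \<and> (\<forall>z\<in>D. i (Inl z) = z)"

definition model_domain :: "(complex ^ 'd) set \<Rightarrow> (complex ^ 'd + 'b) topology \<Rightarrow> bool" where
  "model_domain D X \<longleftrightarrow> (\<exists>i. model_map D X i)"

definition quasi_model_map ::
    "(complex ^ 'd) set \<Rightarrow> (complex ^ 'd + 'b) topology \<Rightarrow> (complex ^ 'd + 'b \<Rightarrow> complex ^ 'd) \<Rightarrow> bool"
  where
  "quasi_model_map D X i \<longleftrightarrow>
     sequentially_continuous_map X (top_of_set (closure D)) i \<and>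
     i ` topspace X = closure D \<and> (\<forall>z\<in>D. i (Inl z) = z)"

definition quasi_model_domain :: "(complex ^ 'd) set \<Rightarrow> (complex ^ 'd + 'b) topology \<Rightarrow> bool" where
  "quasi_model_domain D X \<longleftrightarrow> (\<exists>i. quasi_model_map D X i)"

definition continuous_extension ::
    "(complex ^ 'd) set \<Rightarrow> (complex ^ 'd) set \<Rightarrow>
     (complex ^ 'd \<Rightarrow> complex ^ 'd) \<Rightarrow> (complex ^ 'd \<Rightarrow> complex ^ 'd) \<Rightarrow> bool" where
  "continuous_extension D D' F G \<longleftrightarrow>
     continuous_map (top_of_set (closure D)) (top_of_set (closure D')) G \<and> (\<forall>z\<in>D. G z = F z)"

end

theory Submission
  imports Defs
begin

text \<open>Call the space \<open>T D\<close>, made of \<open>D\<close> and its abstract boundary, the star closure of \<open>D\<close>.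
  The extension passes through the star closures: lift a point of \<open>closure D\<close> to the star closure
  of \<open>D\<close>, transport it by \<open>Fs\<close> to that of \<open>D'\<close>, and project to \<open>closure D'\<close>.  The lift is a
  homeomorphism because \<open>D\<close> is a model domain, and the transport is one by suitability; only the
  projection is merely sequentially continuous, which makes the composite sequentially continuous.
  A star closure is an arbitrary topological space, where this would be a weak property, but the
  composite lives on \<open>closure D\<close>, a metric space, where it amounts to continuity
  (\<open>sequentially_continuous_map_imp_continuous_map\<close>).  On \<open>D\<close> the lift and the projection are the
  identity and the transport is \<open>F\<close>, so the composite extends \<open>F\<close>
  (\<open>continuous_extension_star_composite\<close>).  As \<open>D\<close> is dense in \<open>closure D\<close> and the target is
  Hausdorff, any other extension agrees with it on \<open>closure D\<close> (\<open>continuous_extension_unique\<close>).\<close>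

lemma sequentially_continuous_map_compose_continuous_map:
  assumes g: "continuous_map X Y g" and f: "sequentially_continuous_map Y Z f"
  shows "sequentially_continuous_map X Z (f \<circ> g)"
proof -
  have gX: "g x \<in> topspace Y" if "x \<in> topspace X" for x
    using continuous_map_image_subset_topspace[OF g] that by blast
  have "limitin Z (\<lambda>n. f (g (x n))) (f (g l)) sequentially"
    if "\<forall>n. x n \<in> topspace X" and "limitin X x l sequentially" for x l
    using f gX continuous_map_limit[OF g that(2)] that(1)
    unfolding sequentially_continuous_map_def comp_def by auto
  then show ?thesis
    using f gX unfolding sequentially_continuous_map_def by auto
qed

text \<open>The topology of a metric space is determined by its convergent sequences.\<close>

lemma sequentially_continuous_map_imp_continuous_map:
  fixes f :: "'a::metric_space \<Rightarrow> 'b::topological_space"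
  assumes f: "sequentially_continuous_map (top_of_set S) (top_of_set T) f"
  shows "continuous_map (top_of_set S) (top_of_set T) f"
proof -
  have "continuous_on S f"
    unfolding continuous_on_sequentially
  proof (intro allI ballI impI)
    fix x a assume "a \<in> S" and "(\<forall>n. x n \<in> S) \<and> x \<longlonglongrightarrow> a"
    then have "limitin (top_of_set S) x a sequentially"
      by (simp add: limitin_subtopology)
    then have "limitin (top_of_set T) (\<lambda>n. f (x n)) (f a) sequentially"
      using f \<open>(\<forall>n. x n \<in> S) \<and> _\<close> unfolding sequentially_continuous_map_def by auto
    then show "(f \<circ> x) \<longlonglongrightarrow> f a"
      by (simp add: limitin_subtopology comp_def)
  qed
  moreover have "f ` S \<subseteq> T"
    using f unfolding sequentially_continuous_map_def by simp
  ultimately show ?thesis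
    by (auto simp: continuous_map_in_subtopology)
qed

text \<open>A homeomorphism has some continuous inverse \<open>g\<close>.  The lift is written with \<open>inv_into\<close>, which
  agrees with \<open>g\<close> on the target by injectivity and so inherits its continuity.\<close>

lemma continuous_map_inv_into_homeomorphic_map:
  assumes "homeomorphic_map X Y f"
  shows "continuous_map Y X (inv_into (topspace X) f)"
proof -
  obtain g where g: "homeomorphic_maps X Y f g"
    using assms homeomorphic_map_maps by blast
  have "inv_into (topspace X) f y = g y" if "y \<in> topspace Y" for y
  proof (rule inv_into_f_eq)
    show "inj_on f (topspace X)"
      using assms homeomorphic_imp_injective_map by blast
    show "g y \<in> topspace X" "f (g y) = y"
      using g that continuous_map_image_subset_topspace[of Y X g]
      unfolding homeomorphic_maps_def by auto
  qed
  then show ?thesis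
    using g continuous_map_eq[of Y X g] unfolding homeomorphic_maps_def by auto
qed

lemma continuous_extension_unique:
  assumes G: "continuous_extension D D' F G" and H: "continuous_extension D D' F H"
    and z: "z \<in> closure D"
  shows "G z = H z"
proof (rule forall_in_closure_of_eq[of z _ D "top_of_set (closure D')" G H])
  show "z \<in> top_of_set (closure D) closure_of D"
    using z by (simp add: closure_of_subtopology closure_subset inf.absorb2)
  show "Hausdorff_space (top_of_set (closure D'))"
    by (simp add: Hausdorff_space_subtopology)
qed (use G H in \<open>auto simp: continuous_extension_def\<close>)

lemma continuous_extension_star_composite:
  assumes D: "abstract_boundary D B X"
    and i: "model_map D X i" and i': "quasi_model_map D' X' i'"
    and Fs: "star_extension D X D' X' F Fs"
    and F: "F ` D \<subseteq> D'"
  shows "continuous_extension D D' F (i' \<circ> Fs \<circ> inv_into (topspace X) i)"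
    (is "continuous_extension D D' F ?G")
proof -
  have hom_i: "homeomorphic_map X (top_of_set (closure D)) i"
    using i by (simp add: model_map_def)
  have "continuous_map (top_of_set (closure D)) X' (Fs \<circ> inv_into (topspace X) i)"
    using continuous_map_inv_into_homeomorphic_map[OF hom_i] Fs
    unfolding star_extension_def
    by (blast intro: continuous_map_compose homeomorphic_imp_continuous_map)
  then have "sequentially_continuous_map (top_of_set (closure D)) (top_of_set (closure D')) ?G"
    using i' sequentially_continuous_map_compose_continuous_map
    unfolding quasi_model_map_def comp_assoc by blast
  then have "continuous_map (top_of_set (closure D)) (top_of_set (closure D')) ?G"
    by (rule sequentially_continuous_map_imp_continuous_map)
  moreover have "?G z = F z" if "z \<in> D" for z
  proof -
    have "Inl z \<in> topspace X"
      using D that by (auto simp: abstract_boundary_def)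
    then have "inv_into (topspace X) i z = Inl z"
      using i that homeomorphic_imp_injective_map[OF hom_i]
      by (simp add: model_map_def inv_into_f_eq)
    then show ?thesis
      using Fs i' F that by (auto simp: star_extension_def quasi_model_map_def)
  qed
  ultimately show ?thesis
    by (simp add: continuous_extension_def)
qed

theorem theorem2p6:
  fixes \<D> :: "(complex ^ 'd) set set"
    and bdry :: "(complex ^ 'd) set \<Rightarrow> 'b topology"
    and T :: "(complex ^ 'd) set \<Rightarrow> (complex ^ 'd + 'b) topology"
    and D D' :: "(complex ^ 'd) set"
    and F :: "complex ^ 'd \<Rightarrow> complex ^ 'd"
  assumes "\<And>U. U \<in> \<D> \<Longrightarrow> bounded_domain U"
    and "\<And>U. U \<in> \<D> \<Longrightarrow> abstract_boundary U (bdry U) (T U)"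
    and "suitable \<D> T"
    and "D \<in> \<D>" and "D' \<in> \<D>"
    and "model_domain D (T D)"
    and "quasi_model_domain D' (T D')"
    and "biholomorphism D D' F"
  shows "(\<exists>G. continuous_extension D D' F G) \<and>
    (\<forall>i i' Fs. model_map D (T D) i \<and> quasi_model_map D' (T D') i' \<and>
        star_extension D (T D) D' (T D') F Fs \<longrightarrow>
      continuous_extension D D' F (i' \<circ> Fs \<circ> inv_into (topspace (T D)) i) \<and>
      (\<forall>G. continuous_extension D D' F G \<longrightarrow>
        (\<forall>z\<in>closure D. G z = (i' \<circ> Fs \<circ> inv_into (topspace (T D)) i) z)))"
proof -
  have D: "abstract_boundary D (bdry D) (T D)"
    using assms(2,4) by blast
  have F: "F ` D \<subseteq> D'"
    using assms(8) by (simp add: biholomorphism_def bij_betw_def)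
  note extension = continuous_extension_star_composite[OF D _ _ _ F]
  obtain i i' Fs where "model_map D (T D) i" "quasi_model_map D' (T D') i'"
      "star_extension D (T D) D' (T D') F Fs"
    using assms(3-8) unfolding suitable_def model_domain_def quasi_model_domain_def by meson
  then have "\<exists>G. continuous_extension D D' F G"
    using extension by blast
  then show ?thesis
    using extension continuous_extension_unique by blast
qed

end
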